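(* Let $(X,d)$ be a proper metric space, regarded as a topological coarse space with its metric topology and metric large scale structure. Then $\mathrm{id}_X$ extends to a homeomorphism from the coarse Freudenthal compactification $CF(X)$ onto $X\cup\mathrm{Ends}(X)$.
   Context: The metric large scale structure: uniformly bounded covers are the covers $\mathcal U$ with $\sup_{U\in\mathcal U}\operatorname{diam}U<\infty$; bounded sets are metrically bounded sets. For $A\subset X$, $st(A,\mathcal U)$ is the union of all $U\in\mathcal U$ meeting $A$. $A\subset X$ is coarsely clopen if $st(A,\mathcal U)\cap st(X\setminus A,\mathcal U)$ is bounded for every uniformly bounded cover $\mathcal U$. An end of $X$ is a family $E$ of unbounded, open, coarsely clopen subsets of $X$, maximal among such families closed under finite intersections; $\mathrm{Ends}(X)$ is the set of ends, and for $U\subset X$, $\mathrm{Ends}(U)$ is the set of ends containing $U$. Topology on $X\cup\mathrm{Ends}(X)$: $Y$ is open iff $Y\cap X$ is open in $X$ and for each end $E\in Y$ there is an open coarsely clopen $U\in E$ with $U\cup\mathrm{Ends}(U)\subset Y$. A glacial scale on $X$ is a sequence $\mathcal S=\{(K_i,n_i)\}_{i\ge1}$, $K_i$ bounded, $n_i\in\mathbb N$, such that for every bounded $K$ and $r>0$ there is $i$ with $K\subset K_i$, $n_i>r$; an $\mathcal S$-chain is a finite sequence $x_1,\dots,x_n$ with, for each $i\le n-1$, some $m$ with $x_i,x_{i+1}\notin K_m$ and $d(x_i,x_{i+1})\le n_m$; $f:X\to\mathbb R$ is glacially oscillating if for every $\epsilon>0$ there is a glacial scale $\mathcal S$ with $|f(x_1)-f(x_n)|<\epsilon$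 for all $\mathcal S$-chains. $CF(X)$ is the compactification of $X$ induced by all continuous glacially oscillating functions $X\to[0,1]$. *)

theory Defs
  imports "HOL-Analysis.Analysis"
begin

definition unif_bounded_cover :: "'a::metric_space set set \<Rightarrow> bool" where
  "unif_bounded_cover \<U> \<longleftrightarrow> \<Union>\<U> = UNIV \<and>
     (\<exists>r::real. \<forall>V\<in>\<U>. \<forall>x\<in>V. \<forall>y\<in>V. dist x y \<le> r)"

definition star :: "'a set \<Rightarrow> 'a set set \<Rightarrow> 'a set" where
  "star A \<U> = \<Union>{V\<in>\<U>. V \<inter> A \<noteq> {}}"

definition coarsely_clopen :: "'a::metric_space set \<Rightarrow> bool" where
  "coarsely_clopen A \<longleftrightarrow>
     (\<forall>\<U>. unif_bounded_cover \<U> \<longrightarrow> bounded (star A \<U> \<inter> star (- A) \<U>))"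

definition end_candidate :: "'a::metric_space set \<Rightarrow> bool" where
  "end_candidate U \<longleftrightarrow> \<not> bounded U \<and> open U \<and> coarsely_clopen U"

definition cc_family :: "'a::metric_space set set \<Rightarrow> bool" where
  "cc_family E \<longleftrightarrow> E \<noteq> {} \<and> (\<forall>U\<in>E. end_candidate U) \<and> (\<forall>A\<in>E. \<forall>B\<in>E. A \<inter> B \<in> E)"

definition is_end :: "'a::metric_space set set \<Rightarrow> bool" where
  "is_end E \<longleftrightarrow> cc_family E \<and> (\<forall>E'. cc_family E' \<and> E \<subseteq> E' \<longrightarrow> E' = E)"

definition Ends_of :: "'a::metric_space set \<Rightarrow> 'a set set set" where
  "Ends_of U = {E. is_end E \<and> U \<in> E}"

definition ends_carrier :: "('a::metric_space + 'a set set) set" where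
  "ends_carrier = range Inl \<union> Inr ` {E. is_end E}"

definition ends_topology :: "('a::metric_space + 'a set set) topology" where
  "ends_topology = topology (\<lambda>Y. Y \<subseteq> ends_carrier \<and> open {x. Inl x \<in> Y} \<and>
     (\<forall>E. Inr E \<in> Y \<longrightarrow>
        (\<exists>U\<in>E. open U \<and> coarsely_clopen U \<and> Inl ` U \<union> Inr ` Ends_of U \<subseteq> Y)))"

definition glacial_scale :: "(nat \<Rightarrow> 'a::metric_space set \<times> nat) \<Rightarrow> bool" where
  "glacial_scale S \<longleftrightarrow> (\<forall>i. bounded (fst (S i))) \<and>
     (\<forall>K (r::real). bounded K \<and> r > 0 \<longrightarrow> (\<exists>i. K \<subseteq> fst (S i) \<and> real (snd (S i)) > r))"

definition S_chain :: "(nat \<Rightarrow> 'a::metric_space set \<times> nat) \<Rightarrow> 'a list \<Rightarrow> bool" where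
  "S_chain S xs \<longleftrightarrow> xs \<noteq> [] \<and> (\<forall>i. Suc i < length xs \<longrightarrow>
     (\<exists>m. xs ! i \<notin> fst (S m) \<and> xs ! Suc i \<notin> fst (S m) \<and>
          dist (xs ! i) (xs ! Suc i) \<le> real (snd (S m))))"

definition glacially_oscillating :: "('a::metric_space \<Rightarrow> real) \<Rightarrow> bool" where
  "glacially_oscillating f \<longleftrightarrow> (\<forall>\<epsilon>>0. \<exists>S. glacial_scale S \<and>
     (\<forall>xs. S_chain S xs \<longrightarrow> \<bar>f (hd xs) - f (last xs)\<bar> < \<epsilon>))"

definition CF_functions :: "('a::metric_space \<Rightarrow> real) set" where
  "CF_functions = {f. continuous_on UNIV f \<and> range f \<subseteq> {0..1} \<and> glacially_oscillating f}"

definition CF_eval :: "'a::metric_space \<Rightarrow> (('a \<Rightarrow> real) \<Rightarrow> real)" where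
  "CF_eval x = restrict (\<lambda>f. f x) CF_functions"

definition CF_topology :: "(('a::metric_space \<Rightarrow> real) \<Rightarrow> real) topology" where
  "CF_topology = subtopology (product_topology (\<lambda>_. top_of_set {0..1}) CF_functions)
     ((product_topology (\<lambda>_. top_of_set {0..1}) CF_functions) closure_of (range CF_eval))"

definition proper_metric :: "'a::metric_space itself \<Rightarrow> bool" where
  "proper_metric _ \<longleftrightarrow> (\<forall>K::'a set. bounded K \<and> closed K \<longrightarrow> compact K)"

end

theory Submission
  imports Defs
begin

text \<open>
  A continuous glacially oscillating function has a limit along every end: the points joined by
  chains of a glacial scale to a given set form a coarsely clopen set, and an end, being maximal,
  decides every coarsely clopen set. Evaluating functions at points and taking their limits along
  ends gives a continuous map from \<open>X \<union> Ends(X)\<close> to the cube that contains \<open>CF(X)\<close>. It is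
  injective because \<open>min 1 (d(x, X - U))\<close> is glacially oscillating for coarsely clopen \<open>U\<close>. Since
  \<open>X \<union> Ends(X)\<close> is compact (Zorn's lemma supplies ends avoiding prescribed coarsely clopen sets) and
  \<open>X\<close> is dense in it, the map is a homeomorphism onto \<open>CF(X)\<close>.
\<close>

section \<open>Coarsely clopen sets\<close>

lemma bounded_in_cball:
  assumes "bounded S"
  obtains e where "S \<subseteq> cball c e"
  using assms bounded_any_center[of S c] by (auto simp: subset_iff)

text \<open>This trades covers for radii. A point in both stars of a cover with diameters at most
  \<open>r\<close> is within \<open>r\<close> of some \<open>a\<close> in \<open>A\<close> and some
  \<open>b\<close> outside \<open>A\<close>, so \<open>a\<close> is in the boundary layer of width
  \<open>2 * r\<close> and the point is within \<open>r\<close> of that layer.\<close>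

lemma coarsely_clopen_iff:
  fixes A :: "'a::metric_space set"
  shows "coarsely_clopen A \<longleftrightarrow> (\<forall>r. bounded {x\<in>A. \<exists>y. y \<notin> A \<and> dist x y \<le> r})"
proof
  assume A: "coarsely_clopen A"
  show "\<forall>r. bounded {x\<in>A. \<exists>y. y \<notin> A \<and> dist x y \<le> r}"
  proof
    fix r :: real
    \<comment> \<open>The largest cover of diameter bound \<open>max r 0\<close>: it contains every
      pair of points at distance at most \<open>r\<close>. The maximum with 0 keeps singletons in it
      when \<open>r\<close> is negative.\<close>
    define U :: "'a set set" where "U = {V. \<forall>x\<in>V. \<forall>y\<in>V. dist x y \<le> max r 0}"
    have "{x} \<in> U" for x by (simp add: U_def)
    then have "\<Union>U = UNIV" by blast
    then have "unif_bounded_cover U"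
      unfolding unif_bounded_cover_def by (auto simp: U_def)
    with A have "bounded (star A U \<inter> star (- A) U)" by (simp add: coarsely_clopen_def)
    moreover have "{x\<in>A. \<exists>y. y \<notin> A \<and> dist x y \<le> r} \<subseteq> star A U \<inter> star (- A) U"
    proof (rule subsetI)
      fix x assume "x \<in> {x\<in>A. \<exists>y. y \<notin> A \<and> dist x y \<le> r}"
      then obtain y where "x \<in> A" "y \<notin> A" "dist x y \<le> r" by blast
      moreover from this have "{x, y} \<in> U" by (simp add: U_def dist_commute)
      ultimately show "x \<in> star A U \<inter> star (- A) U" unfolding star_def by blast
    qed
    ultimately show "bounded {x\<in>A. \<exists>y. y \<notin> A \<and> dist x y \<le> r}" by (rule bounded_subset)
  qed
next
  assume bd: "\<forall>r. bounded {x\<in>A. \<exists>y. y \<notin> A \<and> dist x y \<le> r}"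
  show "coarsely_clopen A"
    unfolding coarsely_clopen_def
  proof (intro allI impI)
    fix U :: "'a set set" assume "unif_bounded_cover U"
    then obtain r where r: "\<forall>V\<in>U. \<forall>x\<in>V. \<forall>y\<in>V. dist x y \<le> r"
      unfolding unif_bounded_cover_def by (elim conjE exE)
    obtain c e where ce: "{x\<in>A. \<exists>y. y \<notin> A \<and> dist x y \<le> 2 * r} \<subseteq> cball c e"
      using bd[rule_format, of "2 * r"] unfolding bounded_subset_cball by (elim exE conjE)
    have "star A U \<inter> star (- A) U \<subseteq> cball c (e + r)"
    proof
      fix z assume "z \<in> star A U \<inter> star (- A) U"
      then obtain V W a b where *: "V \<in> U" "z \<in> V" "a \<in> V" "a \<in> A" "W \<in> U" "z \<in> W" "b \<in> W" "b \<notin> A"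
        unfolding star_def by blast
      then have za: "dist z a \<le> r" and zb: "dist z b \<le> r" using r by simp_all
      then have "dist a b \<le> 2 * r" using dist_triangle3[of a b z] by linarith
      with * have "a \<in> cball c e" by (intro subsetD[OF ce]) blast
      then have "dist c a \<le> e" by simp
      with za show "z \<in> cball c (e + r)"
        using dist_triangle[of c z a] by (simp add: dist_commute)
    qed
    then show "bounded (star A U \<inter> star (- A) U)" by (rule bounded_subset[OF bounded_cball])
  qed
qed

lemma coarsely_clopen_Compl: "coarsely_clopen A \<Longrightarrow> coarsely_clopen (- A)"
  by (simp add: coarsely_clopen_def Int_commute)

lemma coarsely_clopen_Int:
  assumes "coarsely_clopen A" "coarsely_clopen B"
  shows "coarsely_clopen (A \<inter> B)"
  unfolding coarsely_clopen_iff
proof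
  fix r
  have "{x \<in> A \<inter> B. \<exists>y. y \<notin> A \<inter> B \<and> dist x y \<le> r} \<subseteq>
    {x \<in> A. \<exists>y. y \<notin> A \<and> dist x y \<le> r} \<union> {x \<in> B. \<exists>y. y \<notin> B \<and> dist x y \<le> r}" by auto
  moreover have "bounded \<dots>" using assms by (simp add: coarsely_clopen_iff)
  ultimately show "bounded {x \<in> A \<inter> B. \<exists>y. y \<notin> A \<inter> B \<and> dist x y \<le> r}"
    using bounded_subset by blast
qed

lemma coarsely_clopen_bounded: "bounded A \<Longrightarrow> coarsely_clopen A"
  unfolding coarsely_clopen_iff by (auto elim: bounded_subset)

lemma coarsely_clopen_UNIV: "coarsely_clopen UNIV"
  by (simp add: coarsely_clopen_iff)

lemma coarsely_clopen_Diff_bounded: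
  "coarsely_clopen A \<Longrightarrow> bounded B \<Longrightarrow> coarsely_clopen (A - B)"
  by (simp add: Diff_eq coarsely_clopen_Int coarsely_clopen_Compl coarsely_clopen_bounded)

text \<open>A point of \<open>A\<close> off its interior has points outside \<open>A\<close> at
  distance less than 1, so it lies in the boundary layer of width 1. Hence passing to the interior,
  which is needed because members of an end are open, costs only a bounded set.\<close>

lemma bounded_Diff_interior:
  assumes "coarsely_clopen A"
  shows "bounded (A - interior A)"
proof -
  have "A - interior A \<subseteq> {x\<in>A. \<exists>y. y \<notin> A \<and> dist x y \<le> 1}"
  proof
    fix x assume x: "x \<in> A - interior A"
    then have "\<not> ball x 1 \<subseteq> A" by (metis DiffD2 mem_interior zero_less_one)
    with x show "x \<in> {x\<in>A. \<exists>y. y \<notin> A \<and> dist x y \<le> 1}" by force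
  qed
  with assms show ?thesis unfolding coarsely_clopen_iff using bounded_subset by blast
qed

lemma coarsely_clopen_interior: "coarsely_clopen A \<Longrightarrow> coarsely_clopen (interior A)"
  by (metis bounded_Diff_interior coarsely_clopen_Diff_bounded double_diff interior_subset subset_refl)

lemma end_candidate_Int:
  "end_candidate A \<Longrightarrow> end_candidate B \<Longrightarrow> \<not> bounded (A \<inter> B) \<Longrightarrow> end_candidate (A \<inter> B)"
  by (auto simp: end_candidate_def coarsely_clopen_Int)

section \<open>Ends as filters\<close>

text \<open>Zorn's lemma applies because two members of the union of a chain already lie in a single
  family of the chain, which contains their intersection.\<close>

lemma end_exists:
  assumes "cc_family E"
  obtains E' where "is_end E'" "E \<subseteq> E'"
proof -
  have "\<exists>M\<in>{F. cc_family F \<and> E \<subseteq> F}. \<forall>F\<in>{F. cc_family F \<and> E \<subseteq> F}. M \<subseteq> F \<longrightarrow> F = M"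
  proof (rule subset_Zorn_nonempty)
    show "{F. cc_family F \<and> E \<subseteq> F} \<noteq> {}" using assms by blast
    fix C assume C: "C \<noteq> {}" "subset.chain {F. cc_family F \<and> E \<subseteq> F} C"
    then have cc: "\<And>F. F \<in> C \<Longrightarrow> cc_family F \<and> E \<subseteq> F"
      and lin: "\<And>F G. F \<in> C \<Longrightarrow> G \<in> C \<Longrightarrow> F \<subseteq> G \<or> G \<subseteq> F"
      unfolding subset_chain_def by blast+
    have "A \<inter> B \<in> \<Union>C" if "A \<in> \<Union>C" "B \<in> \<Union>C" for A B
    proof -
      from that obtain F G where "F \<in> C" "G \<in> C" "A \<in> F" "B \<in> G" by blast
      with lin[of F G] obtain H where "H \<in> C" "A \<in> H" "B \<in> H" by blast
      with cc[of H] show ?thesis unfolding cc_family_def by blast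
    qed
    with C(1) cc show "\<Union>C \<in> {F. cc_family F \<and> E \<subseteq> F}" unfolding cc_family_def by blast
  qed
  then obtain M where M: "cc_family M" "E \<subseteq> M"
    and max: "\<forall>F\<in>{F. cc_family F \<and> E \<subseteq> F}. M \<subseteq> F \<longrightarrow> F = M"
    by (elim bexE CollectE conjE)
  have "F = M" if "cc_family F" "M \<subseteq> F" for F using max that M(2) by auto
  with M show thesis by (intro that[of M]) (simp_all add: is_end_def)
qed

lemma is_endD:
  assumes "is_end E"
  shows end_nonempty: "E \<noteq> {}"
    and end_member_candidate: "\<And>U. U \<in> E \<Longrightarrow> end_candidate U"
    and end_Int: "\<And>U V. U \<in> E \<Longrightarrow> V \<in> E \<Longrightarrow> U \<inter> V \<in> E"
  using assms by (auto simp: is_end_def cc_family_def)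

text \<open>The family \<open>F\<close> of candidates containing some trace
  \<open>U \<inter> W\<close> is closed under intersection, since the traces are unbounded. It
  contains both \<open>E\<close> and \<open>W\<close>, and maximality forces it to equal
  \<open>E\<close>.\<close>

lemma end_memberI:
  assumes E: "is_end E" and W: "open W" "coarsely_clopen W"
    and unb: "\<And>U. U \<in> E \<Longrightarrow> \<not> bounded (U \<inter> W)"
  shows "W \<in> E"
proof -
  define F where "F = {V. end_candidate V \<and> (\<exists>U\<in>E. U \<inter> W \<subseteq> V)}"
  have sub: "E \<subseteq> F" using end_member_candidate[OF E] unfolding F_def by blast
  have "A \<inter> B \<in> F" if A: "A \<in> F" and B: "B \<in> F" for A B
  proof -
    obtain U V where UV: "U \<in> E" "V \<in> E" "U \<inter> W \<subseteq> A" "V \<inter> W \<subseteq> B"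
      using A B unfolding F_def by blast
    then have "U \<inter> V \<in> E" using E end_Int by blast
    moreover have "U \<inter> V \<inter> W \<subseteq> A \<inter> B" using UV by blast
    ultimately show ?thesis
      using unb A B end_candidate_Int[of A B] bounded_subset unfolding F_def by blast
  qed
  then have "cc_family F"
    using sub end_nonempty[OF E] unfolding cc_family_def F_def by blast
  then have "F = E" using E sub by (auto simp: is_end_def)
  moreover have "W \<in> F"
  proof -
    obtain U where "U \<in> E" using end_nonempty[OF E] by blast
    moreover have "\<not> bounded W" using unb[OF \<open>U \<in> E\<close>] bounded_subset by blast
    ultimately show ?thesis using W unfolding F_def end_candidate_def by blast
  qed
  ultimately show ?thesis by simp
qed

text \<open>The filter with base \<open>E\<close>. It allows limits along an end, and it also sees
  sets that are not open and so cannot be members of \<open>E\<close>.\<close>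

definition end_filter :: "'a::metric_space set set \<Rightarrow> 'a filter" where
  "end_filter E = (INF U\<in>E. principal U)"

lemma eventually_end_filter:
  assumes "is_end E"
  shows "eventually P (end_filter E) \<longleftrightarrow> (\<exists>U\<in>E. \<forall>x\<in>U. P x)"
  unfolding end_filter_def
proof (subst eventually_INF_base)
  fix A B assume "A \<in> E" "B \<in> E"
  then have "A \<inter> B \<in> E" using assms end_Int by blast
  then show "\<exists>C\<in>E. principal C \<le> inf (principal A) (principal B)" by auto
qed (use end_nonempty[OF assms] in \<open>auto simp: eventually_principal\<close>)

lemma end_filter_ne_bot: "is_end E \<Longrightarrow> end_filter E \<noteq> bot"
  using end_member_candidate
  by (auto simp: trivial_limit_def eventually_end_filter end_candidate_def)

text \<open>An undecided \<open>A\<close> would have neither its interior nor that of its complement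
  in \<open>E\<close>, so some \<open>U\<close> and \<open>V\<close> in \<open>E\<close> would meet
  these two interiors in bounded sets. The interiors miss only a bounded set of points, so
  \<open>U \<inter> V\<close> would be a bounded member of \<open>E\<close>.\<close>

lemma end_decides:
  assumes E: "is_end E" and A: "coarsely_clopen A"
  shows "eventually (\<lambda>x. x \<in> A) (end_filter E) \<or> eventually (\<lambda>x. x \<notin> A) (end_filter E)"
proof (rule ccontr)
  assume "\<not> ?thesis"
  then have "interior A \<notin> E" "interior (- A) \<notin> E"
    using interior_subset unfolding eventually_end_filter[OF E] by blast+
  then obtain U V where UV: "U \<in> E" "V \<in> E" "bounded (U \<inter> interior A)" "bounded (V \<inter> interior (- A))"
    using end_memberI[OF E] A coarsely_clopen_interior coarsely_clopen_Compl open_interior by metis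
  have "bounded ((U \<inter> interior A) \<union> (V \<inter> interior (- A)) \<union> (A - interior A) \<union> (- A - interior (- A)))"
    using UV A by (simp add: bounded_Diff_interior coarsely_clopen_Compl)
  then have "bounded (U \<inter> V)" by (rule bounded_subset) blast
  moreover have "U \<inter> V \<in> E" using UV E end_Int by blast
  ultimately show False using end_member_candidate[OF E] by (auto simp: end_candidate_def)
qed

lemma eventually_not_in_bounded:
  assumes E: "is_end E" and B: "bounded B"
  shows "eventually (\<lambda>x. x \<notin> B) (end_filter E)"
proof -
  have "\<not> eventually (\<lambda>x. x \<in> B) (end_filter E)"
    using end_member_candidate[OF E] bounded_subset[OF B]
    by (auto simp: eventually_end_filter[OF E] end_candidate_def subset_iff)
  with end_decides[OF E coarsely_clopen_bounded[OF B]] show ?thesis by blast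
qed

text \<open>In effect, an end is closed upwards among open coarsely clopen sets: if \<open>V\<close>
  in \<open>E\<close> lies in \<open>W\<close>, then every \<open>U \<inter> W\<close> contains the
  unbounded set \<open>U \<inter> V\<close>.\<close>

lemma end_member_iff:
  assumes E: "is_end E" and W: "open W" "coarsely_clopen W"
  shows "W \<in> E \<longleftrightarrow> eventually (\<lambda>x. x \<in> W) (end_filter E)"
proof
  assume "eventually (\<lambda>x. x \<in> W) (end_filter E)"
  then obtain V where V: "V \<in> E" "V \<subseteq> W" unfolding eventually_end_filter[OF E] by blast
  show "W \<in> E"
  proof (rule end_memberI[OF E W])
    fix U assume "U \<in> E"
    then have "\<not> bounded (U \<inter> V)"
      using V end_Int[OF E] end_member_candidate[OF E] by (auto simp: end_candidate_def)
    then show "\<not> bounded (U \<inter> W)" using V bounded_subset by (metis Int_mono order_refl)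
  qed
qed (auto simp: eventually_end_filter[OF E])

section \<open>Glacially oscillating functions\<close>

lemma S_chain_snoc:
  assumes xs: "S_chain S xs" and step: "last xs \<notin> fst (S m)" "y \<notin> fst (S m)"
    "dist (last xs) y \<le> real (snd (S m))"
  shows "S_chain S (xs @ [y])"
  unfolding S_chain_def
proof (intro conjI allI impI)
  fix i assume i: "Suc i < length (xs @ [y])"
  show "\<exists>m. (xs @ [y]) ! i \<notin> fst (S m) \<and> (xs @ [y]) ! Suc i \<notin> fst (S m) \<and>
          dist ((xs @ [y]) ! i) ((xs @ [y]) ! Suc i) \<le> real (snd (S m))"
  proof (cases "Suc i < length xs")
    case True
    then show ?thesis using xs by (auto simp: S_chain_def nth_append)
  next
    case False
    with i have l: "length xs = Suc i" by simp
    then have "xs ! i = last xs" by (cases xs rule: rev_cases) auto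
    with l step show ?thesis by (auto simp: nth_append)
  qed
qed auto

text \<open>Once the scale has an \<open>i\<close> with step bound above \<open>r\<close>, any two
  points at distance at most \<open>r\<close> outside the \<open>i\<close>-th bounded set are joined
  by one step. So a pair with one point reachable and the other not must meet that bounded set,
  which bounds the layer of width \<open>r\<close>.\<close>

lemma coarsely_clopen_chain_reachable:
  assumes S: "glacial_scale S"
  shows "coarsely_clopen {last xs |xs. S_chain S xs \<and> hd xs \<in> A}" (is "coarsely_clopen ?C")
  unfolding coarsely_clopen_iff
proof
  fix r
  \<comment> \<open>Only a large step bound is wanted, so the prescribed bounded set is empty;
    \<open>max r 1\<close> meets the demand for a positive radius.\<close>
  have "\<exists>i. {} \<subseteq> fst (S i) \<and> real (snd (S i)) > max r 1"
    using S unfolding glacial_scale_def by (metis bounded_empty less_max_iff_disj zero_less_one)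
  then obtain i where i: "real (snd (S i)) > r" by auto
  have "bounded (fst (S i))" using S by (simp add: glacial_scale_def)
  then obtain c e where ce: "fst (S i) \<subseteq> cball c e" unfolding bounded_subset_cball by (elim exE conjE)
  have "{x \<in> ?C. \<exists>y. y \<notin> ?C \<and> dist x y \<le> r} \<subseteq> cball c (e + max r 0)"
  proof
    fix x assume x: "x \<in> {x \<in> ?C. \<exists>y. y \<notin> ?C \<and> dist x y \<le> r}"
    then obtain y xs where xs: "S_chain S xs" "hd xs \<in> A" "x = last xs"
      and y: "y \<notin> ?C" "dist x y \<le> r" by blast
    have "x \<in> fst (S i) \<or> y \<in> fst (S i)"
    proof (rule ccontr)
      assume "\<not> ?thesis"
      then have "S_chain S (xs @ [y])" using S_chain_snoc[OF xs(1), of i y] xs y i by auto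
      moreover have "hd (xs @ [y]) \<in> A" using xs by (auto simp: S_chain_def)
      moreover have "y = last (xs @ [y])" by simp
      ultimately show False using y(1) by blast
    qed
    then have "dist c x \<le> e \<or> dist c y \<le> e" using ce by auto
    then show "x \<in> cball c (e + max r 0)"
      using y(2) dist_triangle2[of c x y] by auto
  qed
  then show "bounded {x \<in> ?C. \<exists>y. y \<notin> ?C \<and> dist x y \<le> r}" by (rule bounded_subset[OF bounded_cball])
qed

text \<open>Compactness of the unit interval gives a cluster value \<open>l\<close>. The set
  \<open>C\<close> reachable by chains from where \<open>f\<close> is within \<open>e / 2\<close> of
  \<open>l\<close> is coarsely clopen, and \<open>f\<close> stays within \<open>e\<close> of
  \<open>l\<close> on it. The end decides \<open>C\<close> and, \<open>l\<close> being a cluster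
  value, cannot avoid it.\<close>

lemma CF_function_tendsto:
  assumes E: "is_end E" and f: "f \<in> CF_functions"
  obtains l where "l \<in> {0..1}" "(f \<longlongrightarrow> l) (end_filter E)"
proof -
  have ran: "f x \<in> {0..1}" for x using f unfolding CF_functions_def by blast
  \<comment> \<open>A nontrivial infimum of these two filters says that \<open>l\<close> is a
    cluster value of \<open>f\<close> along the end.\<close>
  have "\<exists>l\<in>{0..1}. inf (nhds l) (filtermap f (end_filter E)) \<noteq> bot"
    using compact_Icc[of "0::real" 1] end_filter_ne_bot[OF E] ran
    unfolding compact_filter by (auto simp: filtermap_bot_iff eventually_filtermap)
  then obtain l where l: "l \<in> {0..1}" and cl: "inf (nhds l) (filtermap f (end_filter E)) \<noteq> bot" by blast
  have "(f \<longlongrightarrow> l) (end_filter E)"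
  proof (rule tendstoI)
    fix e :: real assume "e > 0"
    moreover have "glacially_oscillating f" using f by (simp add: CF_functions_def)
    ultimately obtain S where S: "glacial_scale S"
      and osc: "\<And>xs. S_chain S xs \<Longrightarrow> \<bar>f (hd xs) - f (last xs)\<bar> < e / 2"
      unfolding glacially_oscillating_def by (meson half_gt_zero)
    define A where "A = {x. dist (f x) l < e / 2}"
    define C where "C = {last xs |xs. S_chain S xs \<and> hd xs \<in> A}"
    have AC: "A \<subseteq> C"
    proof
      fix x assume "x \<in> A"
      then have "S_chain S [x] \<and> hd [x] \<in> A" by (simp add: S_chain_def)
      then have "last [x] \<in> C" unfolding C_def by blast
      then show "x \<in> C" by simp
    qed
    have C: "dist (f x) l < e" if xC: "x \<in> C" for x
    proof -
      obtain xs where "S_chain S xs" "dist (f (hd xs)) l < e / 2" "x = last xs"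
        using xC unfolding C_def A_def by blast
      moreover from this have "dist (f x) (f (hd xs)) < e / 2"
        using osc[of xs] by (simp add: dist_real_def abs_minus_commute)
      ultimately show ?thesis using dist_triangle[of "f x" l "f (hd xs)"] by linarith
    qed
    have "\<not> eventually (\<lambda>x. x \<notin> C) (end_filter E)"
    proof
      assume "eventually (\<lambda>x. x \<notin> C) (end_filter E)"
      then have "eventually (\<lambda>x. \<not> dist (f x) l < e / 2) (end_filter E)"
        by (rule eventually_mono) (use AC in \<open>auto simp: A_def\<close>)
      then have "eventually (\<lambda>y. \<not> dist y l < e / 2) (filtermap f (end_filter E))"
        by (simp add: eventually_filtermap)
      moreover have "eventually (\<lambda>y. dist y l < e / 2) (nhds l)"
        using \<open>e > 0\<close> unfolding eventually_nhds_metric by (intro exI[of _ "e / 2"]) simp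
      ultimately have "eventually (\<lambda>y. False) (inf (nhds l) (filtermap f (end_filter E)))"
        by (auto simp: eventually_inf)
      with cl show False by (simp add: trivial_limit_def)
    qed
    then have "eventually (\<lambda>x. x \<in> C) (end_filter E)"
      using end_decides[OF E coarsely_clopen_chain_reachable[OF S]] unfolding C_def by blast
    then show "eventually (\<lambda>x. dist (f x) l < e) (end_filter E)"
      by (rule eventually_mono) (rule C)
  qed
  with l show thesis by (rule that)
qed

text \<open>Off a bounded set \<open>f\<close> is the indicator of \<open>A\<close>. Let the
  \<open>n\<close>-th bounded set of the scale contain \<open>B\<close> and the boundary layer of
  \<open>A\<close> of width \<open>n\<close>; then no permitted step crosses between
  \<open>A\<close> and its complement, so \<open>f\<close> is constant along every chain.\<close>

lemma glacially_oscillating_of_coarsely_clopen: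
  fixes f :: "'a::metric_space \<Rightarrow> real"
  assumes A: "coarsely_clopen A" and B: "bounded B"
    and f1: "\<And>x. x \<in> A \<Longrightarrow> x \<notin> B \<Longrightarrow> f x = 1" and f0: "\<And>x. x \<notin> A \<Longrightarrow> x \<notin> B \<Longrightarrow> f x = 0"
  shows "glacially_oscillating f"
proof -
  fix c :: 'a
  define K where "K n = cball c (real n) \<union> B \<union> {x\<in>A. \<exists>y. y \<notin> A \<and> dist x y \<le> real n}" for n
  define S where "S n = (K n, n)" for n
  have "glacial_scale S"
    unfolding glacial_scale_def
  proof (intro conjI allI impI)
    show "bounded (fst (S i))" for i
      using A B by (simp add: S_def K_def coarsely_clopen_iff)
  next
    fix L :: "'a set" and r :: real assume *: "bounded L \<and> r > 0"
    then obtain e where e: "L \<subseteq> cball c e" using bounded_in_cball by blast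
    obtain n where "real n > max e r" using reals_Archimedean2 by blast
    moreover from this e have "L \<subseteq> cball c (real n)" by force
    ultimately have "L \<subseteq> fst (S n) \<and> real (snd (S n)) > r" by (auto simp: S_def K_def)
    then show "\<exists>i. L \<subseteq> fst (S i) \<and> real (snd (S i)) > r" ..
  qed
  moreover have "f (hd xs) = f (last xs)" if xs: "S_chain S xs" for xs
  proof -
    have "i < length xs \<Longrightarrow> f (xs ! i) = f (hd xs)" for i
    proof (induction i)
      case 0
      then show ?case by (simp add: hd_conv_nth)
    next
      case (Suc i)
      then obtain m where m: "xs ! i \<notin> K m" "xs ! Suc i \<notin> K m" "dist (xs ! i) (xs ! Suc i) \<le> real m"
        using xs by (auto simp: S_chain_def S_def)
      \<comment> \<open>The layer in \<open>K m\<close> consists of points of \<open>A\<close> only;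
        whichever end of a crossing step lies in \<open>A\<close> would be in it, and both ends
        avoid \<open>K m\<close>.\<close>
      then have "xs ! i \<in> A \<longleftrightarrow> xs ! Suc i \<in> A"
        by (auto simp: K_def dist_commute)
      with m f1 f0 have "f (xs ! i) = f (xs ! Suc i)"
        by (cases "xs ! i \<in> A") (auto simp: K_def)
      with Suc show ?case by simp
    qed
    moreover have "xs \<noteq> []" using xs by (simp add: S_chain_def)
    ultimately show ?thesis by (simp add: last_conv_nth)
  qed
  ultimately show ?thesis unfolding glacially_oscillating_def by (metis abs_zero diff_self)
qed

section \<open>Functions that separate points and ends\<close>

definition bump :: "'a::metric_space \<Rightarrow> real \<Rightarrow> 'a \<Rightarrow> real" where
  "bump x r = (\<lambda>z. max 0 (1 - dist x z / r))"

lemma bump_eq_0: "r > 0 \<Longrightarrow> z \<notin> cball x r \<Longrightarrow> bump x r z = 0"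
  by (simp add: bump_def)

text \<open>Vanishing outside a ball, the function agrees up to a bounded set with the indicator of
  the empty set. These tents later separate a point from other points and from all ends.\<close>

lemma bump_CF_function:
  assumes "r > 0"
  shows "bump x r \<in> CF_functions"
proof -
  have "glacially_oscillating (bump x r)"
    using assms
    by (intro glacially_oscillating_of_coarsely_clopen[of "{}" "cball x r"])
      (auto simp: coarsely_clopen_bounded bump_eq_0)
  moreover have "continuous_on UNIV (bump x r)"
    unfolding bump_def using assms by (intro continuous_intros) auto
  moreover have "range (bump x r) \<subseteq> {0..1}" using assms by (auto simp: bump_def)
  ultimately show ?thesis by (simp add: CF_functions_def)
qed

text \<open>The truncated distance to the complement of \<open>U\<close> is 1 on \<open>U\<close>
  off a bounded layer and 0 off \<open>U\<close>. The end \<open>E\<close> is eventually in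
  \<open>U\<close> and leaves the layer, while \<open>F\<close>, not having \<open>U\<close> as a
  member, decides against it.\<close>

lemma ends_separated:
  assumes E: "is_end E" and F: "is_end F" and U: "U \<in> E" "U \<notin> F"
  obtains f where "f \<in> CF_functions" "(f \<longlongrightarrow> 1) (end_filter E)" "(f \<longlongrightarrow> 0) (end_filter F)"
proof -
  define f where "f x = min 1 (infdist x (- U))" for x
  define B where "B = {x\<in>U. \<exists>y. y \<notin> U \<and> dist x y \<le> 1}"
  have cc: "open U" "coarsely_clopen U"
    using end_member_candidate[OF E U(1)] by (auto simp: end_candidate_def)
  then have B: "bounded B" by (simp add: B_def coarsely_clopen_iff)
  have FU: "eventually (\<lambda>x. x \<notin> U) (end_filter F)"
    using end_decides[OF F cc(2)] end_member_iff[OF F cc] U by blast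
  \<comment> \<open>The complement of \<open>U\<close> must be nonempty, because
    \<open>infdist\<close> to the empty set is 0 by convention and \<open>f\<close> would then
    vanish everywhere.\<close>
  then obtain V where "V \<in> F" "\<forall>x\<in>V. x \<notin> U" by (auto simp: eventually_end_filter[OF F])
  moreover from this have "V \<noteq> {}" using end_member_candidate[OF F] by (auto simp: end_candidate_def)
  ultimately have ne: "- U \<noteq> {}" by blast
  have f1: "f x = 1" if "x \<in> U" "x \<notin> B" for x
  proof -
    have "1 \<le> infdist x (- U)"
      unfolding infdist_notempty[OF ne] using that ne by (intro cINF_greatest) (auto simp: B_def)
    then show ?thesis by (simp add: f_def)
  qed
  have f0: "f x = 0" if "x \<notin> U" for x using that by (simp add: f_def)
  have "glacially_oscillating f"
    by (rule glacially_oscillating_of_coarsely_clopen[OF cc(2) B]) (use f1 f0 in auto)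
  moreover have "continuous_on UNIV f" unfolding f_def by (intro continuous_intros)
  moreover have "range f \<subseteq> {0..1}" by (auto simp: f_def infdist_nonneg)
  ultimately have "f \<in> CF_functions" by (simp add: CF_functions_def)
  moreover have "eventually (\<lambda>x. f x = 1) (end_filter E)"
    using eventually_not_in_bounded[OF E B] end_member_iff[OF E cc] U
    by (auto elim: eventually_elim2 intro: f1)
  moreover have "eventually (\<lambda>x. f x = 0) (end_filter F)"
    using FU by (rule eventually_mono) (rule f0)
  ultimately show thesis by (intro that tendsto_eventually)
qed

section \<open>The space of points and ends\<close>

text \<open>The defining predicate has to be shown to be a topology before \<open>topology\<close>
  returns it as \<open>openin\<close>. The delicate case is the intersection of two neighbourhoods
  of an end.\<close>

lemma openin_ends_topology:
  fixes Y :: "('a::metric_space + 'a set set) set"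
  shows "openin ends_topology Y \<longleftrightarrow> Y \<subseteq> ends_carrier \<and> open {x. Inl x \<in> Y} \<and>
     (\<forall>E. Inr E \<in> Y \<longrightarrow> (\<exists>U\<in>E. open U \<and> coarsely_clopen U \<and> Inl ` U \<union> Inr ` Ends_of U \<subseteq> Y))"
proof -
  let ?P = "\<lambda>Y :: ('a + 'a set set) set. Y \<subseteq> ends_carrier \<and> open {x. Inl x \<in> Y} \<and>
     (\<forall>E. Inr E \<in> Y \<longrightarrow> (\<exists>U\<in>E. open U \<and> coarsely_clopen U \<and> Inl ` U \<union> Inr ` Ends_of U \<subseteq> Y))"
  have "istopology ?P"
    unfolding istopology_def
  proof (rule conjI; intro allI impI)
    fix Y Z :: "('a + 'a set set) set" assume Y: "?P Y" and Z: "?P Z"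
    have "{x. Inl x \<in> Y \<inter> Z} = {x. Inl x \<in> Y} \<inter> {x. Inl x \<in> Z}" by blast
    moreover have "\<exists>U\<in>E. open U \<and> coarsely_clopen U \<and> Inl ` U \<union> Inr ` Ends_of U \<subseteq> Y \<inter> Z"
      if EYZ: "Inr E \<in> Y \<inter> Z" for E
    proof -
      have E: "is_end E" using EYZ Y by (auto simp: ends_carrier_def)
      obtain U where U: "U \<in> E" "open U" "coarsely_clopen U" "Inl ` U \<union> Inr ` Ends_of U \<subseteq> Y"
        using EYZ Y by (meson IntD1)
      obtain V where V: "V \<in> E" "open V" "coarsely_clopen V" "Inl ` V \<union> Inr ` Ends_of V \<subseteq> Z"
        using EYZ Z by (meson IntD2)
      \<comment> \<open>An end containing \<open>U \<inter> V\<close> contains \<open>U\<close> and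
        \<open>V\<close> by upward closure.\<close>
      have "Ends_of (U \<inter> V) \<subseteq> Ends_of U \<inter> Ends_of V"
        using U V by (auto simp: Ends_of_def end_member_iff coarsely_clopen_Int open_Int
            elim: eventually_mono)
      then have "Inl ` (U \<inter> V) \<union> Inr ` Ends_of (U \<inter> V) \<subseteq> Y \<inter> Z" using U(4) V(4) by blast
      moreover have "U \<inter> V \<in> E" "open (U \<inter> V)" "coarsely_clopen (U \<inter> V)"
        using U V E by (simp_all add: end_Int coarsely_clopen_Int open_Int)
      ultimately show ?thesis by (intro bexI[of _ "U \<inter> V"] conjI)
    qed
    ultimately show "?P (Y \<inter> Z)" using Y Z by auto
  next
    fix \<K> :: "('a + 'a set set) set set" assume K: "\<forall>Y\<in>\<K>. ?P Y"
    have "{x. Inl x \<in> \<Union>\<K>} = (\<Union>Y\<in>\<K>. {x. Inl x \<in> Y})" by blast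
    then have "open {x. Inl x \<in> \<Union>\<K>}" using K by auto
    moreover have "\<exists>U\<in>E. open U \<and> coarsely_clopen U \<and> Inl ` U \<union> Inr ` Ends_of U \<subseteq> \<Union>\<K>"
      if "Inr E \<in> \<Union>\<K>" for E
    proof -
      from that obtain Y where Y: "Y \<in> \<K>" "Inr E \<in> Y" by (elim UnionE)
      with K obtain U where "U \<in> E" "open U" "coarsely_clopen U" "Inl ` U \<union> Inr ` Ends_of U \<subseteq> Y"
        by meson
      moreover from this Y have "Inl ` U \<union> Inr ` Ends_of U \<subseteq> \<Union>\<K>"
        by (meson Sup_upper subset_trans)
      ultimately show ?thesis by (intro bexI[of _ U] conjI)
    qed
    moreover have "\<Union>\<K> \<subseteq> ends_carrier" using K by (intro Union_least) simp
    ultimately show "?P (\<Union>\<K>)" by simp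
  qed
  then show ?thesis unfolding ends_topology_def by (simp only: topology_inverse')
qed

lemma topspace_ends_topology: "topspace ends_topology = ends_carrier"
proof (rule subset_antisym)
  show "topspace ends_topology \<subseteq> ends_carrier"
    using openin_topspace openin_ends_topology by blast
  have "\<exists>U\<in>E. open U \<and> coarsely_clopen U \<and> Inl ` U \<union> Inr ` Ends_of U \<subseteq> ends_carrier"
    if "Inr E \<in> (ends_carrier :: ('a + 'a set set) set)" for E :: "'a set set"
  proof -
    have E: "is_end E" using that by (auto simp: ends_carrier_def)
    then obtain U where "U \<in> E" using end_nonempty by blast
    with end_member_candidate[OF E] show ?thesis
      by (auto simp: end_candidate_def ends_carrier_def Ends_of_def)
  qed
  moreover have "{x. Inl x \<in> (ends_carrier :: ('a + 'a set set) set)} = UNIV"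
    by (auto simp: ends_carrier_def)
  ultimately have "openin ends_topology (ends_carrier :: ('a + 'a set set) set)"
    unfolding openin_ends_topology by simp
  then show "ends_carrier \<subseteq> (topspace ends_topology :: ('a + 'a set set) set)"
    by (rule openin_subset)
qed

lemma points_dense_in_ends:
  "(ends_topology :: ('a::metric_space + 'a set set) topology) closure_of (range Inl) = ends_carrier"
proof (rule subset_antisym)
  show "ends_topology closure_of (range Inl) \<subseteq> (ends_carrier :: ('a + 'a set set) set)"
    by (metis closure_of_subset_topspace topspace_ends_topology)
  show "(ends_carrier :: ('a + 'a set set) set) \<subseteq> ends_topology closure_of (range Inl)"
  proof
    fix p :: "'a + 'a set set" assume p: "p \<in> ends_carrier"
    have "\<exists>y. y \<in> range Inl \<and> y \<in> Y" if Y: "p \<in> Y" "openin ends_topology Y" for Y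
    proof (cases p)
      case (Inl x)
      with Y show ?thesis by blast
    next
      case (Inr E)
      with Y p obtain U where "is_end E" "U \<in> E" "Inl ` U \<subseteq> Y"
        by (auto simp: openin_ends_topology ends_carrier_def)
      moreover from this have "U \<noteq> {}" using end_member_candidate[of E U] by (auto simp: end_candidate_def)
      ultimately show ?thesis by blast
    qed
    with p show "p \<in> ends_topology closure_of (range Inl)"
      by (auto simp: in_closure_of topspace_ends_topology)
  qed
qed

text \<open>Finitely many basic sets, each inside one member of the cover, capture all points but a
  bounded set, since otherwise Zorn's lemma yields an end that they miss. They then capture every
  end too, and properness handles the remaining points.\<close>

lemma compact_ends_topology:
  assumes proper: "proper_metric TYPE('a::metric_space)"
  shows "compact_space (ends_topology :: ('a + 'a set set) topology)"
  unfolding compact_space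
proof (intro allI impI)
  fix \<C> :: "('a + 'a set set) set set"
  assume "Ball \<C> (openin ends_topology) \<and> \<Union>\<C> = topspace ends_topology"
  then have op: "\<And>C. C \<in> \<C> \<Longrightarrow> openin ends_topology C" and cov: "\<Union>\<C> = ends_carrier"
    by (auto simp: topspace_ends_topology)
  define W :: "'a set set" where
    "W = {U. open U \<and> coarsely_clopen U \<and> (\<exists>C\<in>\<C>. Inl ` U \<union> Inr ` Ends_of U \<subseteq> C)}"
  have endW: "\<exists>U\<in>W. U \<in> E" if E: "is_end E" for E
  proof -
    have "Inr E \<in> \<Union>\<C>" using E cov by (auto simp: ends_carrier_def)
    then obtain C where C: "C \<in> \<C>" "Inr E \<in> C" by blast
    with op[of C] show ?thesis unfolding openin_ends_topology W_def by blast
  qed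
  have cover: "\<exists>T. finite T \<and> T \<subseteq> W \<and> bounded (- \<Union>T)"
  proof (rule ccontr)
    assume no: "\<not> ?thesis"
    \<comment> \<open>\<open>R T\<close> is an open substitute for the complement of
      \<open>\<Union>T\<close>, differing from it by a bounded set. If no such complement is
      bounded, the sets \<open>R T\<close> form a family that extends to an end; \<open>R {}\<close>
      is the whole space and keeps the family nonempty.\<close>
    define R where "R T = (\<Inter>U\<in>T. interior (- U))" for T :: "'a set set"
    have R: "open (R T) \<and> coarsely_clopen (R T) \<and> bounded (- \<Union>T - R T)"
      if "finite T" "T \<subseteq> W" for T
      using that
    proof (induction T)
      case empty
      then show ?case by (simp add: R_def coarsely_clopen_UNIV)
    next
      case (insert U T)
      then have U: "coarsely_clopen (- U)" and IH: "open (R T)" "coarsely_clopen (R T)"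
        "bounded (- \<Union>T - R T)" by (auto simp: W_def coarsely_clopen_Compl)
      have eq: "R (insert U T) = interior (- U) \<inter> R T" by (simp add: R_def)
      have "bounded ((- U - interior (- U)) \<union> (- \<Union>T - R T))"
        using IH U bounded_Diff_interior by simp
      then have "bounded (- \<Union>(insert U T) - R (insert U T))"
        unfolding eq by (rule bounded_subset) blast
      then show ?case
        unfolding eq using U IH by (auto simp: coarsely_clopen_Int coarsely_clopen_interior)
    qed
    have unb: "\<not> bounded (R T)" if T: "finite T" "T \<subseteq> W" for T
    proof
      assume "bounded (R T)"
      then have "bounded (R T \<union> (- \<Union>T - R T))" using R[OF T] by (simp only: bounded_Un)
      then have "bounded (- \<Union>T)" by (rule bounded_subset) blast
      with no T show False by blast
    qed
    define E where "E = {R T |T. finite T \<and> T \<subseteq> W}"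
    have "A \<inter> B \<in> E" if AB: "A \<in> E" "B \<in> E" for A B
    proof -
      obtain S T where "finite S" "S \<subseteq> W" "A = R S" "finite T" "T \<subseteq> W" "B = R T"
        using AB unfolding E_def by blast
      moreover have "R S \<inter> R T = R (S \<union> T)" by (auto simp: R_def)
      ultimately show ?thesis unfolding E_def by (metis (mono_tags, lifting) finite_UnI le_sup_iff mem_Collect_eq)
    qed
    moreover have "R {} \<in> E" unfolding E_def by blast
    ultimately have "cc_family E"
      using R unb unfolding cc_family_def E_def end_candidate_def by blast
    then obtain E' where E': "is_end E'" "E \<subseteq> E'" by (rule end_exists)
    \<comment> \<open>The new end also lies in some member of the cover, so it contains a
      \<open>U\<close> from \<open>W\<close> along with the set \<open>R {U}\<close> disjoint from
      it.\<close>
    then obtain U where U: "U \<in> W" "U \<in> E'" using endW by blast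
    then have "R {U} \<in> E'" using E'(2) unfolding E_def by blast
    with U have "U \<inter> R {U} \<in> E'" using end_Int[OF E'(1)] by blast
    moreover have "U \<inter> R {U} = {}" using interior_subset by (fastforce simp: R_def)
    ultimately show False using end_member_candidate[OF E'(1)] by (auto simp: end_candidate_def)
  qed
  then obtain T where T: "finite T" "T \<subseteq> W" "bounded (- \<Union>T)" by blast
  have "\<forall>U\<in>T. \<exists>C. C \<in> \<C> \<and> Inl ` U \<union> Inr ` Ends_of U \<subseteq> C"
    using T(2) unfolding W_def by auto
  then obtain c where c: "\<And>U. U \<in> T \<Longrightarrow> c U \<in> \<C> \<and> Inl ` U \<union> Inr ` Ends_of U \<subseteq> c U"
    by (metis (no_types))
  \<comment> \<open>Properness enters here: the points left over by \<open>T\<close> lie in a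
    compact set, which finitely many further members of the cover contain.\<close>
  have "compact (closure (- \<Union>T))"
    using proper T(3) by (simp add: proper_metric_def bounded_closure)
  moreover have "open {x. Inl x \<in> C}" if "C \<in> \<C>" for C
    using op[OF that] by (simp add: openin_ends_topology)
  moreover have "closure (- \<Union>T) \<subseteq> (\<Union>C\<in>\<C>. {x. Inl x \<in> C})"
    using cov by (auto simp: ends_carrier_def)
  ultimately obtain D where D: "D \<subseteq> \<C>" "finite D" "closure (- \<Union>T) \<subseteq> (\<Union>C\<in>D. {x. Inl x \<in> C})"
    by (rule compactE_image)
  have "p \<in> \<Union>(c ` T \<union> D)" if p: "p \<in> ends_carrier" for p
  proof (cases p)
    case (Inl x)
    show ?thesis
    proof (cases "x \<in> \<Union>T")
      case True
      then show ?thesis using c Inl by blast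
    next
      case False
      then have "x \<in> closure (- \<Union>T)" using closure_subset by blast
      then show ?thesis using D Inl by blast
    qed
  next
    case (Inr E)
    then have E: "is_end E" using p by (auto simp: ends_carrier_def)
    \<comment> \<open>An end without a member in \<open>T\<close> would eventually avoid each of
      these finitely many sets as well as the bounded remainder, hence the whole space.\<close>
    have "\<exists>U\<in>T. U \<in> E"
    proof (rule ccontr)
      assume no: "\<not> ?thesis"
      have "eventually (\<lambda>x. x \<notin> U) (end_filter E)" if "U \<in> T" for U
        using end_decides[OF E] end_member_iff[OF E] no that T(2) unfolding W_def by blast
      then have "eventually (\<lambda>x. \<forall>U\<in>T. x \<notin> U) (end_filter E)"
        using T(1) by (simp add: eventually_ball_finite_distrib)
      with eventually_not_in_bounded[OF E T(3)] have "eventually (\<lambda>x. False) (end_filter E)"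
        by (rule eventually_elim2) blast
      then show False using end_filter_ne_bot[OF E] by (simp add: trivial_limit_def)
    qed
    then obtain U where "U \<in> T" "U \<in> E" by blast
    then show ?thesis using c[of U] E Inr by (auto simp: Ends_of_def)
  qed
  moreover have "finite (c ` T \<union> D)" "c ` T \<union> D \<subseteq> \<C>" using T D c by auto
  ultimately show "\<exists>\<F>. finite \<F> \<and> \<F> \<subseteq> \<C> \<and> \<Union>\<F> = topspace ends_topology"
    unfolding topspace_ends_topology cov[symmetric] by (intro exI[of _ "c ` T \<union> D"]) blast
qed

section \<open>Evaluation at points and ends\<close>

text \<open>The restriction makes values extensional, as points of the product space must be. At an
  end, \<open>Lim\<close> is a true limit by \<open>CF_function_tendsto\<close>.\<close>

definition extended_eval :: "'a::metric_space + 'a set set \<Rightarrow> ('a \<Rightarrow> real) \<Rightarrow> real" where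
  "extended_eval p = restrict
     (\<lambda>f. case p of Inl x \<Rightarrow> f x | Inr E \<Rightarrow> Lim (end_filter E) f) CF_functions"

lemma extended_eval_Inl: "extended_eval (Inl x) = CF_eval x"
  by (simp add: extended_eval_def CF_eval_def)

lemma extended_eval_InrI:
  assumes "is_end E" "f \<in> CF_functions" "(f \<longlongrightarrow> l) (end_filter E)"
  shows "extended_eval (Inr E) f = l"
  using assms by (simp add: extended_eval_def tendsto_Lim end_filter_ne_bot)

lemma tendsto_extended_eval:
  assumes "is_end E" "f \<in> CF_functions"
  shows "(f \<longlongrightarrow> extended_eval (Inr E) f) (end_filter E)"
  using CF_function_tendsto[OF assms] extended_eval_InrI[OF assms] by metis

lemma extended_eval_range:
  assumes "p \<in> ends_carrier" "f \<in> CF_functions"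
  shows "extended_eval p f \<in> {0..1}"
proof (cases p)
  case (Inl x)
  moreover have "f x \<in> {0..1}" using assms unfolding CF_functions_def by blast
  ultimately show ?thesis using assms by (simp add: extended_eval_def)
next
  case (Inr E)
  then have "is_end E" using assms by (auto simp: ends_carrier_def)
  then show ?thesis
    using CF_function_tendsto[of E f] extended_eval_InrI[of E f] assms Inr by metis
qed

lemma continuous_extended_eval_component:
  assumes f: "f \<in> CF_functions"
  shows "continuous_map ends_topology (top_of_set {0..1}) (\<lambda>p. extended_eval p f)"
  unfolding continuous_map_in_subtopology
proof
  show "(\<lambda>p. extended_eval p f) \<in> topspace ends_topology \<rightarrow> {0..1}"
    using extended_eval_range[OF _ f] by (simp add: topspace_ends_topology)
  show "continuous_map ends_topology euclidean (\<lambda>p. extended_eval p f)"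
    unfolding continuous_map_def
  proof (intro conjI allI impI)
    fix V :: "real set" assume "openin euclidean V"
    then have V: "open V" by simp
    have "open (f -` V)" using f V by (simp add: CF_functions_def open_vimage)
    moreover have "{x. Inl x \<in> {p \<in> topspace ends_topology. extended_eval p f \<in> V}} = f -` V"
      using f by (auto simp: topspace_ends_topology ends_carrier_def extended_eval_def)
    moreover have "\<exists>U\<in>E. open U \<and> coarsely_clopen U \<and>
        Inl ` U \<union> Inr ` Ends_of U \<subseteq> {p \<in> topspace ends_topology. extended_eval p f \<in> V}"
      if "Inr E \<in> {p \<in> topspace ends_topology. extended_eval p f \<in> V}" for E
    proof -
      have E: "is_end E" and EV: "extended_eval (Inr E) f \<in> V"
        using that by (auto simp: topspace_ends_topology ends_carrier_def)
      \<comment> \<open>A closed ball inside \<open>V\<close>: if \<open>f\<close> maps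
        \<open>U\<close> into it, the limits of \<open>f\<close> along all ends containing
        \<open>U\<close> stay in it too.\<close>
      obtain e where e: "e > 0" "cball (extended_eval (Inr E) f) e \<subseteq> V"
        using V EV open_contains_cball by blast
      have "eventually (\<lambda>x. f x \<in> cball (extended_eval (Inr E) f) e) (end_filter E)"
        using tendstoD[OF tendsto_extended_eval[OF E f] e(1)]
        by (rule eventually_mono) (simp add: dist_commute)
      then obtain U where U: "U \<in> E" "\<And>x. x \<in> U \<Longrightarrow> f x \<in> cball (extended_eval (Inr E) f) e"
        unfolding eventually_end_filter[OF E] by blast
      have "extended_eval (Inr F) f \<in> V" if F: "is_end F" "U \<in> F" for F
      proof -
        have "eventually (\<lambda>x. f x \<in> cball (extended_eval (Inr E) f) e) (end_filter F)"
          unfolding eventually_end_filter[OF F(1)] using U F by blast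
        then have "extended_eval (Inr F) f \<in> cball (extended_eval (Inr E) f) e"
          using Lim_in_closed_set[OF closed_cball _ end_filter_ne_bot[OF F(1)]
              tendsto_extended_eval[OF F(1) f]] by blast
        then show ?thesis using e by blast
      qed
      moreover have "extended_eval (Inl x) f \<in> V" if "x \<in> U" for x
        using U(2)[OF that] e f by (auto simp: extended_eval_def)
      ultimately have "Inl ` U \<union> Inr ` Ends_of U \<subseteq> {p \<in> topspace ends_topology. extended_eval p f \<in> V}"
        by (auto simp: Ends_of_def topspace_ends_topology ends_carrier_def)
      then show ?thesis
        using U(1) end_member_candidate[OF E] by (auto simp: end_candidate_def)
    qed
    ultimately show "openin ends_topology {p \<in> topspace ends_topology. extended_eval p f \<in> V}"
      unfolding openin_ends_topology by (auto simp: topspace_ends_topology)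
  qed auto
qed

lemma continuous_extended_eval:
  "continuous_map ends_topology (product_topology (\<lambda>_. top_of_set {0..1}) CF_functions) extended_eval"
  by (auto simp: continuous_map_componentwise continuous_extended_eval_component)
    (simp add: extended_eval_def)

lemma inj_on_extended_eval: "inj_on extended_eval (ends_carrier :: ('a::metric_space + 'a set set) set)"
proof -
  have points: "extended_eval (Inl x) \<noteq> extended_eval (Inl y)" if "x \<noteq> y" for x y :: 'a
  proof
    assume "extended_eval (Inl x) = extended_eval (Inl y)"
    then have "extended_eval (Inl x) (bump x (dist x y)) = extended_eval (Inl y) (bump x (dist x y))"
      by simp
    with that have "bump x (dist x y) x = bump x (dist x y) y"
      by (simp add: extended_eval_def bump_CF_function)
    with that show False by (simp add: bump_def)
  qed
  have point_end: "extended_eval (Inl x) \<noteq> extended_eval (Inr E)" if E: "is_end E" for x :: 'a and E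
  proof
    assume eq: "extended_eval (Inl x) = extended_eval (Inr E)"
    have "eventually (\<lambda>z. bump x 1 z = 0) (end_filter E)"
      using eventually_not_in_bounded[OF E bounded_cball[of x 1]]
      by (rule eventually_mono) (rule bump_eq_0[OF zero_less_one])
    then have "extended_eval (Inr E) (bump x 1) = 0"
      by (intro extended_eval_InrI E bump_CF_function tendsto_eventually) auto
    moreover have "extended_eval (Inl x) (bump x 1) = 1"
      by (simp add: extended_eval_def bump_CF_function) (simp add: bump_def)
    ultimately show False using eq by simp
  qed
  have ends: "E = F" if E: "is_end E" and F: "is_end F" and eq: "extended_eval (Inr E) = extended_eval (Inr F)"
    for E F :: "'a set set"
  proof (rule ccontr)
    assume "E \<noteq> F"
    \<comment> \<open>By maximality an end contained in another end equals it.\<close>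
    then have "\<not> E \<subseteq> F" using E F by (auto simp: is_end_def)
    then obtain U where "U \<in> E" "U \<notin> F" by blast
    then obtain f where "f \<in> CF_functions" "(f \<longlongrightarrow> 1) (end_filter E)" "(f \<longlongrightarrow> 0) (end_filter F)"
      by (rule ends_separated[OF E F])
    then have "extended_eval (Inr E) f = 1" "extended_eval (Inr F) f = 0"
      using extended_eval_InrI E F by blast+
    with eq show False by simp
  qed
  show ?thesis
  proof (rule inj_onI)
    fix p q :: "'a + 'a set set"
    assume pq: "p \<in> ends_carrier" "q \<in> ends_carrier" "extended_eval p = extended_eval q"
    show "p = q"
    proof (cases p; cases q)
      fix x y assume "p = Inl x" "q = Inl y"
      with pq points show ?thesis by blast
    next
      fix x E assume c: "p = Inl x" "q = Inr E"
      with pq have "is_end E" by (auto simp: ends_carrier_def)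
      with c pq point_end show ?thesis by blast
    next
      fix x E assume c: "p = Inr E" "q = Inl x"
      with pq have "is_end E" by (auto simp: ends_carrier_def)
      with c pq point_end show ?thesis by metis
    next
      fix E F assume c: "p = Inr E" "q = Inr F"
      with pq have "is_end E" "is_end F" by (auto simp: ends_carrier_def)
      with c pq ends show ?thesis by blast
    qed
  qed
qed

text \<open>A continuous bijection from a compact space to a Hausdorff space is a
  homeomorphism.\<close>

lemma homeomorphic_map_extended_eval:
  assumes proper: "proper_metric TYPE('a::metric_space)"
  shows "homeomorphic_map (ends_topology :: ('a + 'a set set) topology) CF_topology extended_eval"
proof -
  let ?P = "product_topology (\<lambda>_. top_of_set {0..1::real}) (CF_functions :: ('a \<Rightarrow> real) set)"
  let ?T = "ends_topology :: ('a + 'a set set) topology"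
  have range_eq: "extended_eval ` range Inl = range (CF_eval :: 'a \<Rightarrow> _)"
    by (auto simp: extended_eval_Inl image_image)
  have haus: "Hausdorff_space ?P"
    by (auto simp: Hausdorff_space_product_topology Hausdorff_space_subtopology)
  have top: "topspace CF_topology = ?P closure_of range CF_eval"
    unfolding CF_topology_def topspace_subtopology by (rule Int_absorb1[OF closure_of_subset_topspace])
  \<comment> \<open>Density of the points puts the image inside the closure defining
    \<open>CF_topology\<close>. Conversely the image is compact, hence closed in the Hausdorff cube,
    and contains all point evaluations.\<close>
  have img: "extended_eval ` topspace ?T = topspace CF_topology"
  proof
    have "extended_eval ` (?T closure_of range Inl) \<subseteq> ?P closure_of (extended_eval ` range Inl)"
      by (rule continuous_map_image_closure_subset[OF continuous_extended_eval])
    then show "extended_eval ` topspace ?T \<subseteq> topspace CF_topology"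
      by (simp only: top points_dense_in_ends topspace_ends_topology range_eq)
    have "compactin ?P (extended_eval ` topspace ?T)"
      using compact_ends_topology[OF proper] continuous_extended_eval
      unfolding compact_space_def by (rule image_compactin)
    then have "closedin ?P (extended_eval ` topspace ?T)"
      using haus compactin_imp_closedin by blast
    moreover have "range CF_eval \<subseteq> extended_eval ` topspace ?T"
      unfolding range_eq[symmetric] topspace_ends_topology by (auto simp: ends_carrier_def)
    ultimately show "topspace CF_topology \<subseteq> extended_eval ` topspace ?T"
      unfolding top by (rule closure_of_minimal[rotated])
  qed
  have "continuous_map ?T CF_topology extended_eval"
    using continuous_extended_eval img unfolding top
    unfolding CF_topology_def continuous_map_in_subtopology by auto
  moreover have "Hausdorff_space (CF_topology :: (('a \<Rightarrow> real) \<Rightarrow> real) topology)"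
    unfolding CF_topology_def using haus by (rule Hausdorff_space_subtopology)
  ultimately show ?thesis
    using compact_ends_topology[OF proper] img inj_on_extended_eval
    by (intro continuous_imp_homeomorphic_map) (auto simp: topspace_ends_topology)
qed

theorem theorem6p17:
  assumes "proper_metric TYPE('a::metric_space)"
  shows "\<exists>h. homeomorphic_map (CF_topology :: (('a \<Rightarrow> real) \<Rightarrow> real) topology) ends_topology h \<and>
             (\<forall>x::'a. h (CF_eval x) = Inl x)"
proof -
  \<comment> \<open>The required map starts from the compactification, so it is the inverse of
    \<open>extended_eval\<close>; it sends \<open>CF_eval x\<close> back to \<open>Inl x\<close>
    because \<open>extended_eval\<close> extends \<open>CF_eval\<close>.\<close>
  obtain h where h: "homeomorphic_maps (ends_topology :: ('a + 'a set set) topology) CF_topology extended_eval h"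
    using homeomorphic_map_extended_eval[OF assms] homeomorphic_map_maps by blast
  have "h (CF_eval x) = Inl x" for x :: 'a
    using h by (auto simp: homeomorphic_maps_def topspace_ends_topology ends_carrier_def
        simp flip: extended_eval_Inl)
  moreover have "homeomorphic_map CF_topology ends_topology h"
    using h homeomorphic_maps_map homeomorphic_maps_sym by blast
  ultimately show ?thesis by blast
qed

end
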